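(* Let $\nu$ be a probability measure on $\Omega\times(\mathbb{N}\cup\{\infty\})$. The following four conditions are equivalent: (a) $\nu$ is a stopping measure; (b) $\nu$ is the detailed distribution of some (at least one) randomized stopping time; (c) $\nu$ is the detailed distribution of some (at least one) behavior stopping time; (d) $\nu$ is the detailed distribution of some (at least one) mixed stopping time.
   Context: $\mathbb{N}=\{1,2,\dots\}$, $I=[0,1]$, $\mathcal{B}$ is the Borel $\sigma$-algebra of $I$, $\lambda$ is Lebesgue measure on $I$. $(\Omega,\mathcal{F},P)$ is a fixed probability space with a filtration $(\mathcal{F}_n)_{n\in\mathbb{N}}$, and $\mathcal{F}=\mathcal{F}_\infty:=\sigma(\mathcal{F}_n,\ n\in\mathbb{N})$. The set $\Omega\times(\mathbb{N}\cup\{\infty\})$ carries the product of $\mathcal{F}$ with the discrete $\sigma$-algebra. No completeness of the $\mathcal F_n$ is assumed. A process $(Y_n)$ is adapted if each $Y_n$ is $\mathcal{F}_n$-measurable (including $n=\infty$ if it is an index). Stopping time: a function $\sigma:\Omega\to\mathbb{N}\cup\{\infty\}$ with $\{\sigma=n\}\in\mathcal{F}_n$ for every $n\in\mathbb{N}\cup\{\infty\}$. Randomized stopping time: a nonnegative adapted real-valued process $\rho=(\rho_n)_{n\in\mathbb{N}\cup\{\infty\}}$ with $\sum_{n\in\mathbb{N}\cup\{\infty\}}\rho_n(\omega)=1$ for every $\omega\in\Omega$. Its detailed distribution is $\mathbf{P}_\rho(A\times\{n\})=\mathbf{E}_P[\mathbf{1}_A\rho_n]$ for $A\in\mathcal{F}$,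 $n\in\mathbb{N}\cup\{\infty\}$. Behavior stopping time: an adapted $[0,1]$-valued process $\beta=(\beta_n)_{n\in\mathbb{N}}$. Its detailed distribution is $\mathbf{P}_\beta(A\times\{n\})=\mathbf{E}_P[\mathbf{1}_A(\prod_{j<n}(1-\beta_j))\beta_n]$ for $A\in\mathcal F$, $n\in\mathbb{N}$, and $\mathbf{P}_\beta(A\times\{\infty\})=\mathbf{E}_P[\mathbf{1}_A\prod_{j\in\mathbb{N}}(1-\beta_j)]$ for $A\in\mathcal F$. Mixed stopping time: a $(\mathcal{B}\times\mathcal{F})$-measurable function $\mu:I\times\Omega\to\mathbb{N}\cup\{\infty\}$ such that for every $r\in I$ the function $\mu(r,\cdot)$ is a stopping time. Its detailed distribution is $\mathbf{P}_\mu(A\times\{n\})=\int_0^1P(\{\omega\in A:\mu(r,\omega)=n\})\,dr$ for $A\in\mathcal F$, $n\in\mathbb{N}\cup\{\infty\}$. Stopping measure: a probability measure $\nu$ on $\Omega\times(\mathbb{N}\cup\{\infty\})$ whose projection to $\Omega$ is $P$ and such that the densities $\rho_n$, defined for $n\in\mathbb{N}\cup\{\infty\}$ by $\nu(A\times\{n\})=\int_A\rho_n\,dP$ for every $A\in\mathcal{F}$, satisfy: for every $n\in\mathbb{N}$ (and therefore also for $n=\infty$), $\rho_n$ is equal $P$-a.s. to some $\mathcal{F}_n$-measurable function. *)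

theory Defs
  imports "HOL-Probability.Probability"
begin

text \<open>
  Time is counted from 1, so the set of extended times is \<^term>\<open>{1..} :: enat set\<close>, which
  contains \<^term>\<open>\<infinity> :: enat\<close>; the finite times are \<^term>\<open>{1..<\<infinity>} :: enat set\<close>. Values of
  processes and filtrations at index 0 are never referred to.
\<close>

abbreviation ext_times :: "enat set"
  where "ext_times \<equiv> {1..}"

text \<open>
  The filtration is indexed by extended times, its member at infinity being the \<open>\<sigma>\<close>-algebra
  generated by the others. Only the \<open>\<sigma>\<close>-algebra of \<open>F n\<close> is relevant, not its measure; the
  probability measure is that of \<open>M\<close>.
\<close>

locale filtered_prob_space = prob_space M
  for M :: "'a measure" +
  fixes F :: "enat \<Rightarrow> 'a measure"
  assumes space_F: "\<And>n. 1 \<le> n \<Longrightarrow> space (F n) = space M"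
    and sets_F_mono: "\<And>m n. 1 \<le> m \<Longrightarrow> m \<le> n \<Longrightarrow> sets (F m) \<subseteq> sets (F n)"
    and sets_F_infinity: "sets (F \<infinity>) = sigma_sets (space M) (\<Union>n\<in>{1..<\<infinity>}. sets (F n))"
    and sets_M: "sets M = sets (F \<infinity>)"

text \<open>
  The library's \<^const>\<open>stopping_time\<close> asks for the events \<open>T \<le> t\<close>, for \<open>t\<close> ranging over a whole
  type; here the events are \<open>T = n\<close> and index 0 is excluded.
\<close>

definition discrete_stopping_time :: "'a measure \<Rightarrow> (enat \<Rightarrow> 'a measure) \<Rightarrow> ('a \<Rightarrow> enat) \<Rightarrow> bool"
  where "discrete_stopping_time M F T \<longleftrightarrow>
    T \<in> space M \<rightarrow> ext_times \<and> (\<forall>n\<in>ext_times. {\<omega> \<in> space M. T \<omega> = n} \<in> sets (F n))"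

definition randomized_stopping_time ::
    "'a measure \<Rightarrow> (enat \<Rightarrow> 'a measure) \<Rightarrow> (enat \<Rightarrow> 'a \<Rightarrow> real) \<Rightarrow> bool"
  where "randomized_stopping_time M F \<rho> \<longleftrightarrow>
    (\<forall>n\<in>ext_times. \<rho> n \<in> borel_measurable (F n) \<and> (\<forall>\<omega>\<in>space M. 0 \<le> \<rho> n \<omega>)) \<and>
    (\<forall>\<omega>\<in>space M. ((\<lambda>n. \<rho> n \<omega>) has_sum 1) ext_times)"

definition behavior_stopping_time ::
    "'a measure \<Rightarrow> (enat \<Rightarrow> 'a measure) \<Rightarrow> (nat \<Rightarrow> 'a \<Rightarrow> real) \<Rightarrow> bool"
  where "behavior_stopping_time M F \<beta> \<longleftrightarrow>
    (\<forall>n\<ge>1. \<beta> n \<in> borel_measurable (F (enat n)) \<and> (\<forall>\<omega>\<in>space M. \<beta> n \<omega> \<in> {0..1}))"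

definition mixed_stopping_time ::
    "'a measure \<Rightarrow> (enat \<Rightarrow> 'a measure) \<Rightarrow> (real \<Rightarrow> 'a \<Rightarrow> enat) \<Rightarrow> bool"
  where "mixed_stopping_time M F \<mu> \<longleftrightarrow>
    (\<lambda>(r, \<omega>). \<mu> r \<omega>) \<in> restrict_space borel {0..1} \<Otimes>\<^sub>M M \<rightarrow>\<^sub>M count_space ext_times \<and>
    (\<forall>r\<in>{0..1}. discrete_stopping_time M F (\<mu> r))"

text \<open>
  A measure \<open>\<nu>\<close> on the product of \<open>M\<close> with the extended times is determined by its values on the
  sets \<open>A \<times> {n}\<close>. A detailed distribution is therefore given as a function \<open>D\<close> of \<open>A\<close> and \<open>n\<close>.
\<close>

definition has_detailed_distribution ::
    "'a measure \<Rightarrow> ('a \<times> enat) measure \<Rightarrow> ('a set \<Rightarrow> enat \<Rightarrow> ennreal) \<Rightarrow> bool"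
  where "has_detailed_distribution M \<nu> D \<longleftrightarrow>
    sets \<nu> = sets (M \<Otimes>\<^sub>M count_space ext_times) \<and>
    (\<forall>A\<in>sets M. \<forall>n\<in>ext_times. emeasure \<nu> (A \<times> {n}) = D A n)"

definition randomized_detailed ::
    "'a measure \<Rightarrow> (enat \<Rightarrow> 'a \<Rightarrow> real) \<Rightarrow> 'a set \<Rightarrow> enat \<Rightarrow> ennreal"
  where "randomized_detailed M \<rho> A n = (\<integral>\<^sup>+\<omega>\<in>A. ennreal (\<rho> n \<omega>) \<partial>M)"

text \<open>
  The infinite product is the limit of the partial products. The library's \<^const>\<open>prodinf\<close> is
  unsuitable: it is unspecified when the partial products tend to 0 without any factor being 0.
\<close>

definition behavior_detailed ::
    "'a measure \<Rightarrow> (nat \<Rightarrow> 'a \<Rightarrow> real) \<Rightarrow> 'a set \<Rightarrow> enat \<Rightarrow> ennreal"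
  where "behavior_detailed M \<beta> A n = (case n of
      enat k \<Rightarrow> (\<integral>\<^sup>+\<omega>\<in>A. ennreal ((\<Prod>j\<in>{1..<k}. 1 - \<beta> j \<omega>) * \<beta> k \<omega>) \<partial>M)
    | \<infinity> \<Rightarrow> (\<integral>\<^sup>+\<omega>\<in>A. ennreal (lim (\<lambda>k. \<Prod>j\<in>{1..k}. 1 - \<beta> j \<omega>)) \<partial>M))"

definition mixed_detailed ::
    "'a measure \<Rightarrow> (real \<Rightarrow> 'a \<Rightarrow> enat) \<Rightarrow> 'a set \<Rightarrow> enat \<Rightarrow> ennreal"
  where "mixed_detailed M \<mu> A n = (\<integral>\<^sup>+r\<in>{0..1}. emeasure M {\<omega> \<in> A. \<mu> r \<omega> = n} \<partial>lborel)"

text \<open>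
  The densities are unique only up to null sets, and the condition on them does not depend on the
  choice; hence the existential quantifier over \<open>\<rho>\<close>.
\<close>

definition stopping_measure ::
    "'a measure \<Rightarrow> (enat \<Rightarrow> 'a measure) \<Rightarrow> ('a \<times> enat) measure \<Rightarrow> bool"
  where "stopping_measure M F \<nu> \<longleftrightarrow>
    prob_space \<nu> \<and>
    sets \<nu> = sets (M \<Otimes>\<^sub>M count_space ext_times) \<and>
    distr \<nu> M fst = M \<and>
    (\<exists>\<rho> :: enat \<Rightarrow> 'a \<Rightarrow> real.
      (\<forall>n\<in>ext_times. \<rho> n \<in> borel_measurable M \<and> (\<forall>\<omega>\<in>space M. 0 \<le> \<rho> n \<omega>) \<and>
        (\<forall>A\<in>sets M. emeasure \<nu> (A \<times> {n}) = (\<integral>\<^sup>+\<omega>\<in>A. ennreal (\<rho> n \<omega>) \<partial>M))) \<and>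
      (\<forall>n\<in>{1..<\<infinity>}. \<exists>g\<in>borel_measurable (F n). AE \<omega> in M. \<rho> n \<omega> = g \<omega>))"

end

theory Submission
  imports Defs
begin

text \<open>
  The four conditions are linked in a cycle: a stopping measure comes from a behavior stopping time,
  a behavior stopping time yields a randomized one, a randomized one yields a mixed one, and the
  detailed distribution of a mixed stopping time is a stopping measure.

  Let \<open>\<nu>\<close> be a stopping measure, with densities \<open>\<rho>\<^sub>n\<close> that agree almost surely with adapted \<open>g\<^sub>n\<close> at
  finite times. Almost surely the \<open>\<rho>\<^sub>n\<close> are the lengths of pieces into which a stick of length 1 is
  broken, and \<open>\<beta>\<^sub>n\<close> has to be the fraction \<open>g\<^sub>n / (1 - g\<^sub>1 - \<dots> - g\<^sub>n\<^sub>-\<^sub>1)\<close> of the remainder that is broken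
  off at time \<open>n\<close>. Clipping this quotient to \<open>[0,1]\<close> gives a process that is adapted and
  \<open>[0,1]\<close>-valued everywhere, and all exceptional points lie in one null set, on which the densities
  do not matter (\<open>stopping_measure_imp_behavior\<close>). For every \<open>\<beta>\<close> with values in \<open>[0,1]\<close>, the
  masses \<open>(\<Prod>j<n. 1 - \<beta>\<^sub>j) * \<beta>\<^sub>n\<close> telescope and, together with the limit of the products, add up
  to 1 at every point, not just almost surely (\<open>behavior_imp_randomized\<close>); passing through \<open>\<beta>\<close> thus
  repairs the exceptional null set without leaving the \<open>\<sigma>\<close>-algebras of the filtration.

  Given a randomized stopping time, lay the intervals of length \<open>\<rho>\<^sub>1, \<rho>\<^sub>2, \<dots>\<close> side by side from 0, and
  let \<open>\<mu> r \<omega>\<close> be the index of the interval containing \<open>r\<close>, and \<open>\<infinity>\<close> if there is none. By Fubini,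
  \<open>\<mu>\<close> has the right detailed distribution (\<open>randomized_imp_mixed\<close>).

  The only step that needs more than bookkeeping is the return to stopping measures. The density is
  \<open>h\<^sub>n \<omega> = \<lambda>{r. \<mu> r \<omega> = n}\<close>, and the event \<open>\<mu> = n\<close> is known to be measurable for \<open>F n\<close> only for fixed
  \<open>r\<close>; jointly in \<open>(r, \<omega>)\<close> it is measurable merely for the big \<open>\<sigma>\<close>-algebra, so \<open>h\<^sub>n\<close> need not be
  measurable for \<open>F n\<close>. It does agree almost surely with its conditional expectation given \<open>F n\<close>,
  because conditional expectation can be moved across each section separately
  (\<open>AE_section_measure_eq_cond_exp\<close>).
\<close>

section \<open>Sums over the extended times\<close>

lemma ext_times_eq: "ext_times = insert \<infinity> (range (\<lambda>k. enat (Suc k)))"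
proof -
  have "n \<in> insert \<infinity> (range (\<lambda>k. enat (Suc k)))" if n: "1 \<le> n" for n
  proof (cases n)
    case (enat m)
    then obtain k where "m = Suc k"
      using n enat by (cases m) (auto simp: one_enat_def)
    then show ?thesis
      using enat by auto
  qed simp
  then show ?thesis
    by (auto simp: one_enat_def)
qed

lemma ext_times_cases:
  assumes "n \<in> ext_times"
  obtains (finite) k where "n = enat (Suc k)" | (infinite) "n = \<infinity>"
  using assms unfolding ext_times_eq by auto

lemma enat_Suc_in_ext_times [simp]: "1 \<le> enat (Suc k)"
  by (simp add: one_enat_def)

text \<open>
  Unordered sums over the extended times are traded for ordinary series here, so that convergence
  of partial sums and telescoping become available.
\<close>

lemma has_sum_ext_times_iff:
  fixes f :: "enat \<Rightarrow> real"
  assumes "\<And>n. n \<in> ext_times \<Longrightarrow> 0 \<le> f n"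
  shows "(f has_sum s) ext_times \<longleftrightarrow> (\<lambda>k. f (enat (Suc k))) sums (s - f \<infinity>)"
proof
  let ?R = "range (\<lambda>k. enat (Suc k))"
  have inj: "inj (\<lambda>k. enat (Suc k))"
    by (auto intro: injI)
  have insert: "(f has_sum (f \<infinity> + t)) ext_times" if "(f has_sum t) ?R" for t
    unfolding ext_times_eq by (rule has_sum_insert) (use that in auto)
  show "(f has_sum s) ext_times" if "(\<lambda>k. f (enat (Suc k))) sums (s - f \<infinity>)"
    using insert[of "s - f \<infinity>"] sums_nonneg_imp_has_sum[OF that] assms
    by (simp add: has_sum_reindex[OF inj] o_def)
  show "(\<lambda>k. f (enat (Suc k))) sums (s - f \<infinity>)" if s: "(f has_sum s) ext_times"
  proof -
    have "f summable_on ?R"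
      by (rule summable_on_subset_banach[OF has_sum_imp_summable[OF s]]) auto
    then obtain t where t: "(f has_sum t) ?R"
      by (auto simp: summable_on_def)
    then have "s = f \<infinity> + t"
      using insert s has_sum_unique by blast
    then show ?thesis
      using has_sum_imp_sums t by (simp add: has_sum_reindex[OF inj] o_def)
  qed
qed

lemma nn_integral_ext_times:
  fixes f :: "enat \<Rightarrow> ennreal"
  shows "(\<integral>\<^sup>+n. f n \<partial>count_space ext_times) = f \<infinity> + (\<Sum>k. f (enat (Suc k)))"
proof -
  \<comment> \<open>Put \<open>\<infinity>\<close> first, so that the extended times are enumerated by the natural numbers.\<close>
  define e where "e n = (case n of 0 \<Rightarrow> \<infinity> | Suc k \<Rightarrow> enat (Suc k))" for n :: nat
  have "bij_betw e UNIV ext_times"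
    unfolding ext_times_eq bij_betw_def
    by (auto simp: e_def inj_on_def image_iff split: nat.splits)
  then have "(\<integral>\<^sup>+n. f n \<partial>count_space ext_times) = (\<Sum>n. f (e n))"
    by (simp flip: nn_integral_bij_count_space add: nn_integral_count_space_nat)
  also have "\<dots> = (\<Sum>k. f (e (Suc k))) + f (e 0)"
    using suminf_offset[of "\<lambda>n. f (e n)" 1] by simp
  finally show ?thesis
    by (simp add: e_def add.commute)
qed

lemma sums_of_nn_integral_ext_times_eq_1:
  fixes f :: "enat \<Rightarrow> real"
  assumes nonneg: "\<And>n. n \<in> ext_times \<Longrightarrow> 0 \<le> f n"
    and eq_1: "(\<integral>\<^sup>+n. ennreal (f n) \<partial>count_space ext_times) = 1"
  shows "(\<lambda>k. f (enat (Suc k))) sums (1 - f \<infinity>)"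
proof -
  let ?g = "\<lambda>k. f (enat (Suc k))"
  have eq: "ennreal (f \<infinity>) + (\<Sum>k. ennreal (?g k)) = 1"
    using eq_1 by (simp add: nn_integral_ext_times)
  have "summable ?g"
    by (rule summable_suminf_not_top) (use eq nonneg in \<open>auto simp: ennreal_add_eq_top\<close>)
  moreover have "ennreal (f \<infinity> + suminf ?g) = 1"
    using eq nonneg \<open>summable ?g\<close> by (simp add: suminf_ennreal2 suminf_nonneg ennreal_plus)
  ultimately show ?thesis
    by (auto simp: sums_iff)
qed

section \<open>Stick breaking\<close>

text \<open>
  The clipping is inactive as long as the piece fits into the remainder. When the remainder \<open>R\<close> is
  zero, the piece is zero as well, and the convention \<open>0 / 0 = 0\<close> does no harm.
\<close>

lemma stick_breaking_step:
  fixes g R :: real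
  assumes "0 \<le> g" "g \<le> R"
  shows "R * max 0 (min 1 (g / R)) = g"
  using assms by (cases "R = 0") (auto simp: min_def max_def divide_le_eq_1 zero_le_divide_iff)

text \<open>
  Each factor \<open>1 - \<beta> n\<close> takes the remainder before time \<open>n\<close> to the remainder after it.
\<close>

lemma stick_breaking_prod:
  fixes g :: "nat \<Rightarrow> real"
  defines "\<beta> \<equiv> \<lambda>n. max 0 (min 1 (g n / (1 - sum g {1..<n})))"
  assumes nonneg: "\<And>n. 1 \<le> n \<Longrightarrow> 0 \<le> g n"
    and le_1: "\<And>n. sum g {1..n} \<le> 1"
  shows "(\<Prod>j\<in>{1..n}. 1 - \<beta> j) = 1 - sum g {1..n}"
proof (induction n)
  case (Suc n)
  have "(1 - sum g {1..n}) * \<beta> (Suc n) = g (Suc n)"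
    unfolding \<beta>_def atLeastLessThanSuc_atLeastAtMost
    using le_1[of "Suc n"] nonneg[of "Suc n"] by (intro stick_breaking_step) auto
  then show ?case
    using Suc by (simp add: right_diff_distrib)
qed simp

text \<open>
  The sum telescopes: each summand is the drop of the product at one step.
\<close>

lemma sum_broken_pieces:
  fixes \<beta> :: "nat \<Rightarrow> 'b::comm_ring_1"
  shows "(\<Sum>k<n. (\<Prod>j\<in>{1..k}. 1 - \<beta> j) * \<beta> (Suc k)) = 1 - (\<Prod>j\<in>{1..n}. 1 - \<beta> j)"
  by (induction n) (simp_all add: algebra_simps)

lemma convergent_prod_1_minus:
  fixes \<beta> :: "nat \<Rightarrow> real"
  assumes "\<And>n. 1 \<le> n \<Longrightarrow> \<beta> n \<in> {0..1}"
  shows "convergent (\<lambda>n. \<Prod>j\<in>{1..n}. 1 - \<beta> j)"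
proof (rule Bseq_monoseq_convergent)
  have "0 \<le> (\<Prod>j\<in>{1..n}. 1 - \<beta> j)" "(\<Prod>j\<in>{1..n}. 1 - \<beta> j) \<le> 1" for n
    using assms by (auto intro!: prod_nonneg prod_le_1)
  then show "Bseq (\<lambda>n. \<Prod>j\<in>{1..n}. 1 - \<beta> j)"
    by (intro BseqI'[of _ 1]) simp
  have "decseq (\<lambda>n. \<Prod>j\<in>{1..n}. 1 - \<beta> j)"
    using assms by (intro decseq_SucI) (auto intro!: mult_left_le prod_nonneg)
  then show "monoseq (\<lambda>n. \<Prod>j\<in>{1..n}. 1 - \<beta> j)"
    by (simp add: decseq_imp_monoseq)
qed

section \<open>Densities and sections\<close>

lemma (in sigma_finite_measure) AE_eq_if_set_nn_integral_eq:
  assumes [measurable]: "f \<in> borel_measurable M" "g \<in> borel_measurable M"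
    and "\<And>A. A \<in> sets M \<Longrightarrow> (\<integral>\<^sup>+\<omega>\<in>A. f \<omega> \<partial>M) = (\<integral>\<^sup>+\<omega>\<in>A. g \<omega> \<partial>M)"
  shows "AE \<omega> in M. f \<omega> = g \<omega>"
proof (rule density_unique)
  show "density M f = density M g"
    by (rule measure_eqI) (use assms(3) in \<open>auto simp: emeasure_density\<close>)
qed simp_all

text \<open>
  Joint measurability of \<open>H\<close> refers to \<open>M\<close>, whereas only the sections of \<open>H\<close> at fixed \<open>r\<close> lie in the
  subalgebra \<open>F\<close>; hence the function \<open>h\<close> that measures the sections at fixed \<open>\<omega>\<close> need not be
  \<open>F\<close>-measurable, and equality can be claimed almost everywhere only. The reason for it is that for
  \<open>A\<close> in \<open>M\<close>, writing \<open>E\<close> for the conditional expectation given \<open>F\<close>,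
  \<open>\<integral>h 1\<^sub>A = \<integral>\<integral>1\<^sub>H 1\<^sub>A = \<integral>\<integral>1\<^sub>H E(1\<^sub>A) = \<integral>h E(1\<^sub>A) = \<integral>E(h) E(1\<^sub>A) = \<integral>E(h) 1\<^sub>A\<close>,
  where the second equality is the defining property of \<open>E\<close> applied for each fixed \<open>r\<close>.
\<close>

lemma (in sigma_finite_subalgebra) AE_section_measure_eq_cond_exp:
  assumes "sigma_finite_measure L"
    and H [measurable]: "H \<in> sets (L \<Otimes>\<^sub>M M)"
    and sect: "\<And>r. r \<in> space L \<Longrightarrow> Pair r -` H \<in> sets F"
  shows "AE \<omega> in M. emeasure L ((\<lambda>r. (r, \<omega>)) -` H) =
    nn_cond_exp M F (\<lambda>\<omega>. emeasure L ((\<lambda>r. (r, \<omega>)) -` H)) \<omega>"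
proof -
  \<comment> \<open>Named before the interpretations below, which give the same name to a fact about the product.\<close>
  note AE_eqI = AE_eq_if_set_nn_integral_eq
  interpret L: sigma_finite_measure L by fact
  interpret pair_sigma_finite L M ..
  let ?h = "\<lambda>\<omega>. emeasure L ((\<lambda>r. (r, \<omega>)) -` H)"
  have meas_h [measurable]: "?h \<in> borel_measurable M"
    by (rule measurable_emeasure_Pair2) (rule H)
  have swap: "(\<integral>\<^sup>+\<omega>. c \<omega> * ?h \<omega> \<partial>M) = (\<integral>\<^sup>+r. \<integral>\<^sup>+\<omega>. indicator (Pair r -` H) \<omega> * c \<omega> \<partial>M \<partial>L)"
    if [measurable]: "c \<in> borel_measurable M" for c
  proof -
    have sec [measurable]: "(\<lambda>r. (r, \<omega>)) -` H \<in> sets L" for \<omega>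
      by (rule sets_Pair2) (rule H)
    have "(\<integral>\<^sup>+\<omega>. c \<omega> * ?h \<omega> \<partial>M) = (\<integral>\<^sup>+\<omega>. \<integral>\<^sup>+r. c \<omega> * indicator ((\<lambda>r. (r, \<omega>)) -` H) r \<partial>L \<partial>M)"
      by (simp add: nn_integral_cmult)
    also have "\<dots> = (\<integral>\<^sup>+\<omega>. \<integral>\<^sup>+r. indicator H (r, \<omega>) * c \<omega> \<partial>L \<partial>M)"
      by (intro nn_integral_cong) (simp add: indicator_def)
    also have "\<dots> = (\<integral>\<^sup>+r. \<integral>\<^sup>+\<omega>. indicator H (r, \<omega>) * c \<omega> \<partial>M \<partial>L)"
      by (rule Fubini') measurable
    also have "\<dots> = (\<integral>\<^sup>+r. \<integral>\<^sup>+\<omega>. indicator (Pair r -` H) \<omega> * c \<omega> \<partial>M \<partial>L)"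
      by (simp add: indicator_def vimage_def)
    finally show ?thesis .
  qed
  show ?thesis
  proof (rule AE_eqI)
    fix A assume A [measurable]: "A \<in> sets M"
    let ?c = "nn_cond_exp M F (indicator A)"
    have "(\<integral>\<^sup>+\<omega>\<in>A. ?h \<omega> \<partial>M) = (\<integral>\<^sup>+r. \<integral>\<^sup>+\<omega>. indicator (Pair r -` H) \<omega> * indicator A \<omega> \<partial>M \<partial>L)"
      by (subst swap[symmetric]) (simp_all add: mult.commute)
    also have "\<dots> = (\<integral>\<^sup>+r. \<integral>\<^sup>+\<omega>. indicator (Pair r -` H) \<omega> * ?c \<omega> \<partial>M \<partial>L)"
      by (intro nn_integral_cong nn_cond_exp_intg[symmetric] borel_measurable_indicator sect) auto
    also have "\<dots> = (\<integral>\<^sup>+\<omega>. ?c \<omega> * ?h \<omega> \<partial>M)"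
      by (rule swap[symmetric]) simp
    also have "\<dots> = (\<integral>\<^sup>+\<omega>. ?c \<omega> * nn_cond_exp M F ?h \<omega> \<partial>M)"
      by (rule nn_cond_exp_intg[symmetric]) simp_all
    also have "\<dots> = (\<integral>\<^sup>+\<omega>. nn_cond_exp M F ?h \<omega> * ?c \<omega> \<partial>M)"
      by (simp add: mult.commute)
    also have "\<dots> = (\<integral>\<^sup>+\<omega>\<in>A. nn_cond_exp M F ?h \<omega> \<partial>M)"
      by (rule nn_cond_exp_intg) simp_all
    finally show "(\<integral>\<^sup>+\<omega>\<in>A. ?h \<omega> \<partial>M) = (\<integral>\<^sup>+\<omega>\<in>A. nn_cond_exp M F ?h \<omega> \<partial>M)" .
  qed simp_all
qed

section \<open>Adaptedness\<close>

context filtered_prob_space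
begin

lemma subalgebra_F:
  assumes "1 \<le> n"
  shows "subalgebra M (F n)"
  using assms space_F[OF assms] sets_F_mono[of n \<infinity>] sets_M by (auto simp: subalgebra_def)

lemma measurable_F_mono:
  assumes "f \<in> borel_measurable (F m)" "1 \<le> m" "m \<le> n"
  shows "f \<in> borel_measurable (F n)"
  using measurable_from_subalg[of "F n" "F m"] assms space_F sets_F_mono[of m n]
    order_trans[OF assms(2,3)]
  by (auto simp: subalgebra_def)

section \<open>From stopping measures to behavior stopping times\<close>

text \<open>
  That \<open>\<nu>\<close> projects to \<open>M\<close> says precisely that the densities add up to 1 almost surely. Together with
  the countably many almost sure identities \<open>\<rho>\<^sub>n = g\<^sub>n\<close> this gives one null set outside of which the
  clipped quotients break the stick into the pieces \<open>\<rho>\<^sub>n\<close>; the piece at \<open>\<infinity>\<close> is what remains in the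
  limit.
\<close>

lemma stopping_measure_imp_behavior:
  assumes \<nu>: "stopping_measure M F \<nu>"
  shows "\<exists>\<beta>. behavior_stopping_time M F \<beta> \<and>
    has_detailed_distribution M \<nu> (behavior_detailed M \<beta>)"
proof -
  have sets_\<nu> [measurable_cong]: "sets \<nu> = sets (M \<Otimes>\<^sub>M count_space ext_times)"
    and proj: "distr \<nu> M fst = M"
    using \<nu> by (auto simp: stopping_measure_def)
  have space_\<nu>: "space \<nu> = space M \<times> ext_times"
    using sets_eq_imp_space_eq[OF sets_\<nu>] by (simp add: space_pair_measure)
  obtain \<rho> where \<rho>: "\<And>n. n \<in> ext_times \<Longrightarrow> \<rho> n \<in> borel_measurable M"
      and \<rho>_nonneg: "\<And>n \<omega>. n \<in> ext_times \<Longrightarrow> \<omega> \<in> space M \<Longrightarrow> 0 \<le> \<rho> n \<omega>"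
      and dens: "\<And>n A. n \<in> ext_times \<Longrightarrow> A \<in> sets M \<Longrightarrow>
        emeasure \<nu> (A \<times> {n}) = (\<integral>\<^sup>+\<omega>\<in>A. ennreal (\<rho> n \<omega>) \<partial>M)"
      and ver: "\<forall>n\<in>{1..<\<infinity>}. \<exists>g\<in>borel_measurable (F n). AE \<omega> in M. \<rho> n \<omega> = g \<omega>"
    using \<nu> unfolding stopping_measure_def by blast
  from bchoice[OF ver[unfolded Bex_def]] obtain g0
    where g0: "\<forall>n\<in>{1..<\<infinity>}. g0 n \<in> borel_measurable (F n) \<and> (AE \<omega> in M. \<rho> n \<omega> = g0 n \<omega>)"
    by blast
  define g where "g n = g0 (enat n)" for n
  have g [measurable]: "g n \<in> borel_measurable (F (enat n))"
    and AE_g: "AE \<omega> in M. \<rho> (enat n) \<omega> = g n \<omega>" if "1 \<le> n" for n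
    using that g0 by (auto simp: g_def one_enat_def)
  have meas_tot: "(\<lambda>\<omega>. \<integral>\<^sup>+n. ennreal (\<rho> n \<omega>) \<partial>count_space ext_times) \<in> borel_measurable M"
    unfolding nn_integral_ext_times using \<rho> by measurable
  have "AE \<omega> in M. (\<integral>\<^sup>+n. ennreal (\<rho> n \<omega>) \<partial>count_space ext_times) = 1"
  proof (rule AE_eq_if_set_nn_integral_eq[OF meas_tot])
    fix A assume A [measurable]: "A \<in> sets M"
    have "(\<integral>\<^sup>+\<omega>\<in>A. (\<integral>\<^sup>+n. ennreal (\<rho> n \<omega>) \<partial>count_space ext_times) \<partial>M) =
        (\<integral>\<^sup>+\<omega>. \<integral>\<^sup>+n. ennreal (\<rho> n \<omega>) * indicator A \<omega> \<partial>count_space ext_times \<partial>M)"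
      by (simp add: nn_integral_multc)
    also have "\<dots> = (\<integral>\<^sup>+n. (\<integral>\<^sup>+\<omega>\<in>A. ennreal (\<rho> n \<omega>) \<partial>M) \<partial>count_space ext_times)"
      using \<rho> by (intro nn_integral_count_space_nn_integral) auto
    also have "\<dots> = (\<integral>\<^sup>+n. emeasure \<nu> (A \<times> {n}) \<partial>count_space ext_times)"
      using A by (intro nn_integral_cong) (simp add: dens)
    also have "\<dots> = emeasure \<nu> (\<Union>n\<in>ext_times. A \<times> {n})"
      using A by (intro emeasure_UN_countable[symmetric])
        (auto simp: disjoint_family_on_def sets_\<nu>)
    also have "(\<Union>n\<in>ext_times. A \<times> {n}) = fst -` A \<inter> space \<nu>"
      using sets.sets_into_space[OF A] by (auto simp: space_\<nu>)
    also have "emeasure \<nu> \<dots> = emeasure (distr \<nu> M fst) A"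
      by (rule emeasure_distr[symmetric]) simp_all
    also have "\<dots> = (\<integral>\<^sup>+\<omega>\<in>A. 1 \<partial>M)"
      by (simp add: proj)
    finally show "(\<integral>\<^sup>+\<omega>\<in>A. (\<integral>\<^sup>+n. ennreal (\<rho> n \<omega>) \<partial>count_space ext_times) \<partial>M) = (\<integral>\<^sup>+\<omega>\<in>A. 1 \<partial>M)" .
  qed simp
  moreover have "AE \<omega> in M. \<forall>k. \<rho> (enat (Suc k)) \<omega> = g (Suc k) \<omega>"
    unfolding AE_all_countable using AE_g by simp
  ultimately have AE_good: "AE \<omega> in M. (\<lambda>k. g (Suc k) \<omega>) sums (1 - \<rho> \<infinity> \<omega>) \<and>
      (\<forall>k. 0 \<le> g (Suc k) \<omega> \<and> \<rho> (enat (Suc k)) \<omega> = g (Suc k) \<omega>)"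
    using AE_space
  proof eventually_elim
    case (elim \<omega>)
    then show ?case
      using sums_of_nn_integral_ext_times_eq_1[of "\<lambda>n. \<rho> n \<omega>"] \<rho>_nonneg[OF _ elim(3)]
        \<rho>_nonneg[of "enat (Suc _)", OF _ elim(3)]
      by (metis (no_types, lifting) atLeast_iff enat_Suc_in_ext_times sums_cong)
  qed
  define \<beta> where "\<beta> n \<omega> = max 0 (min 1 (g n \<omega> / (1 - (\<Sum>j\<in>{1..<n}. g j \<omega>))))" for n \<omega>
  have g_F: "g j \<in> borel_measurable (F (enat n))" if "1 \<le> j" "j \<le> n" for j n
    using measurable_F_mono[OF g[OF that(1)]] that by (simp add: one_enat_def)
  have "behavior_stopping_time M F \<beta>"
    unfolding behavior_stopping_time_def
  proof (intro allI impI conjI ballI)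
    fix n :: nat assume "1 \<le> n"
    show "\<beta> n \<in> borel_measurable (F (enat n))"
      unfolding \<beta>_def using g_F \<open>1 \<le> n\<close>
      by (intro borel_measurable_max borel_measurable_min borel_measurable_divide
          borel_measurable_diff borel_measurable_sum borel_measurable_const) auto
  qed (simp add: \<beta>_def)
  moreover have "has_detailed_distribution M \<nu> (behavior_detailed M \<beta>)"
    unfolding has_detailed_distribution_def
  proof (intro conjI ballI)
    have AE_prod: "AE \<omega> in M. (\<forall>n. (\<Prod>j\<in>{1..n}. 1 - \<beta> j \<omega>) = 1 - (\<Sum>k<n. g (Suc k) \<omega>)) \<and>
        (\<lambda>k. g (Suc k) \<omega>) sums (1 - \<rho> \<infinity> \<omega>) \<and>
        (\<forall>k. \<rho> (enat (Suc k)) \<omega> = (\<Prod>j\<in>{1..k}. 1 - \<beta> j \<omega>) * \<beta> (Suc k) \<omega>)"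
      using AE_good AE_space
    proof eventually_elim
      case (elim \<omega>)
      have sum_eq: "(\<Sum>j\<in>{1..n}. g j \<omega>) = (\<Sum>k<n. g (Suc k) \<omega>)" for n
        by (simp add: sum.atLeast1_atMost_eq)
      have sum_le: "(\<Sum>k<n. g (Suc k) \<omega>) \<le> 1" for n
        using elim \<rho>_nonneg[of \<infinity> \<omega>] sum_le_suminf[of "\<lambda>k. g (Suc k) \<omega>" "{..<n}"]
        by (auto simp: sums_iff)
      have nonneg: "0 \<le> g n \<omega>" if "1 \<le> n" for n
        using elim that by (cases n) auto
      have prod: "(\<Prod>j\<in>{1..n}. 1 - \<beta> j \<omega>) = 1 - (\<Sum>k<n. g (Suc k) \<omega>)" for n
        unfolding \<beta>_def sum_eq[symmetric]
        by (rule stick_breaking_prod) (use nonneg sum_le in \<open>auto simp only: sum_eq\<close>)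
      have "(1 - (\<Sum>k<n. g (Suc k) \<omega>)) * \<beta> (Suc n) \<omega> = g (Suc n) \<omega>" for n
        using sum_le[of "Suc n"] nonneg[of "Suc n"]
        unfolding \<beta>_def atLeastLessThanSuc_atLeastAtMost sum_eq
        by (intro stick_breaking_step) auto
      with prod elim show ?case
        by simp
    qed
    fix A n assume A: "A \<in> sets M" and n: "n \<in> ext_times"
    show "emeasure \<nu> (A \<times> {n}) = behavior_detailed M \<beta> A n"
      using n
    proof (cases rule: ext_times_cases)
      case (finite k)
      have "AE \<omega> in M. \<rho> n \<omega> = (\<Prod>j\<in>{1..<Suc k}. 1 - \<beta> j \<omega>) * \<beta> (Suc k) \<omega>"
        using AE_prod by eventually_elim (simp add: finite atLeastLessThanSuc_atLeastAtMost)
      then show ?thesis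
        unfolding dens[OF n A] unfolding behavior_detailed_def finite enat.case
        by (intro nn_integral_cong_AE) auto
    next
      case infinite
      have "AE \<omega> in M. \<rho> \<infinity> \<omega> = lim (\<lambda>n. \<Prod>j\<in>{1..n}. 1 - \<beta> j \<omega>)"
        using AE_prod
      proof eventually_elim
        case (elim \<omega>)
        have "(\<lambda>n. 1 - (\<Sum>k<n. g (Suc k) \<omega>)) \<longlonglongrightarrow> 1 - (1 - \<rho> \<infinity> \<omega>)"
          using elim by (intro tendsto_intros) (simp add: sums_def)
        then show ?case
          using elim by (simp add: limI)
      qed
      then show ?thesis
        unfolding dens[OF n A] unfolding behavior_detailed_def infinite enat.case
        by (intro nn_integral_cong_AE) auto
    qed
  qed (rule sets_\<nu>)
  ultimately show ?thesis
    by blast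
qed

section \<open>From behavior to randomized stopping times\<close>

text \<open>
  The masses are the pieces broken off by \<open>\<beta>\<close>, and the mass at \<open>\<infinity>\<close> is the limit \<open>L\<close> of the remainders.
  The partial sums of the former are \<open>1\<close> minus the remainder, so that they tend to \<open>1 - L\<close>.
\<close>

lemma behavior_imp_randomized:
  assumes "behavior_stopping_time M F \<beta>"
  shows "\<exists>\<rho>. randomized_stopping_time M F \<rho> \<and>
    (\<forall>A. \<forall>n\<in>ext_times. randomized_detailed M \<rho> A n = behavior_detailed M \<beta> A n)"
proof -
  define Q where "Q n \<omega> = (\<Prod>j\<in>{1..n}. 1 - \<beta> j \<omega>)" for n \<omega>
  define \<rho> where "\<rho> n \<omega> = (case n of enat k \<Rightarrow> (\<Prod>j\<in>{1..<k}. 1 - \<beta> j \<omega>) * \<beta> k \<omega>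
    | \<infinity> \<Rightarrow> lim (\<lambda>k. Q k \<omega>))" for n \<omega>
  have \<rho>_Suc: "\<rho> (enat (Suc k)) \<omega> = Q k \<omega> * \<beta> (Suc k) \<omega>" for k \<omega>
    by (simp add: \<rho>_def Q_def atLeastLessThanSuc_atLeastAtMost)
  have \<rho>_inf: "\<rho> \<infinity> \<omega> = lim (\<lambda>k. Q k \<omega>)" for \<omega>
    by (simp add: \<rho>_def)
  have \<beta>: "\<beta> n \<in> borel_measurable (F (enat n))"
    and \<beta>_01: "\<And>\<omega>. \<omega> \<in> space M \<Longrightarrow> \<beta> n \<omega> \<in> {0..1}" if "1 \<le> n" for n
    using assms that by (auto simp: behavior_stopping_time_def)
  have \<beta>_F: "\<beta> j \<in> borel_measurable (F n)" if "1 \<le> j" "enat j \<le> n" for j n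
    using measurable_F_mono[OF \<beta>[OF that(1)]] that by (simp add: one_enat_def)
  have Q_F: "Q k \<in> borel_measurable (F n)" if "enat k \<le> n" for k n
    unfolding Q_def
    by (intro borel_measurable_prod borel_measurable_diff borel_measurable_const \<beta>_F)
      (use that order_trans[of "enat _" "enat k" n] in auto)
  have Q_nonneg: "0 \<le> Q k \<omega>" if "\<omega> \<in> space M" for k \<omega>
    unfolding Q_def using \<beta>_01[OF _ that] by (intro prod_nonneg) auto
  have Q_lim: "(\<lambda>k. Q k \<omega>) \<longlonglongrightarrow> \<rho> \<infinity> \<omega>" if "\<omega> \<in> space M" for \<omega>
    unfolding \<rho>_inf Q_def convergent_LIMSEQ_iff[symmetric]
    using \<beta>_01[OF _ that] by (rule convergent_prod_1_minus)
  have \<rho>_nonneg: "0 \<le> \<rho> n \<omega>" if "n \<in> ext_times" "\<omega> \<in> space M" for n \<omega>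
    using that(1)
  proof (cases rule: ext_times_cases)
    case (finite k)
    then show ?thesis
      using Q_nonneg[OF that(2)] \<beta>_01[of "Suc k", OF _ that(2)] by (simp add: \<rho>_Suc)
  next
    case infinite
    then show ?thesis
      using Q_lim[OF that(2)] Q_nonneg[OF that(2)] by (auto intro: LIMSEQ_le_const)
  qed
  have "randomized_stopping_time M F \<rho>"
    unfolding randomized_stopping_time_def
  proof (intro conjI ballI)
    fix n assume n: "n \<in> ext_times"
    from n show "\<rho> n \<in> borel_measurable (F n)"
    proof (cases rule: ext_times_cases)
      case (finite k)
      have "(\<lambda>\<omega>. Q k \<omega> * \<beta> (Suc k) \<omega>) \<in> borel_measurable (F n)"
        by (intro borel_measurable_times Q_F \<beta>_F) (auto simp: finite)
      then show ?thesis
        by (simp add: finite \<rho>_Suc[abs_def])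
    next
      case infinite
      show ?thesis
        unfolding infinite
        by (rule borel_measurable_LIMSEQ_real[where u = Q])
          (use Q_lim Q_F space_F[of \<infinity>] in auto)
    qed
    show "0 \<le> \<rho> n \<omega>" if "\<omega> \<in> space M" for \<omega>
      using \<rho>_nonneg n that by blast
  next
    fix \<omega> assume \<omega>: "\<omega> \<in> space M"
    have "(\<lambda>n. 1 - Q n \<omega>) \<longlonglongrightarrow> 1 - \<rho> \<infinity> \<omega>"
      by (intro tendsto_intros Q_lim \<omega>)
    then have "(\<lambda>k. \<rho> (enat (Suc k)) \<omega>) sums (1 - \<rho> \<infinity> \<omega>)"
      unfolding sums_def \<rho>_Suc Q_def sum_broken_pieces[of "\<lambda>n. \<beta> n \<omega>"] .
    then show "((\<lambda>n. \<rho> n \<omega>) has_sum 1) ext_times"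
      using \<rho>_nonneg \<omega> by (subst has_sum_ext_times_iff) auto
  qed
  moreover have "randomized_detailed M \<rho> A n = behavior_detailed M \<beta> A n" for A n
    by (simp add: randomized_detailed_def behavior_detailed_def \<rho>_def Q_def split: enat.split)
  ultimately show ?thesis
    by blast
qed

section \<open>From randomized to mixed stopping times\<close>

abbreviation uniform :: "real measure"
  where "uniform \<equiv> restrict_space lborel {0..1}"

lemma prob_space_uniform: "prob_space uniform"
  by (rule prob_spaceI) (simp add: emeasure_restrict_space space_restrict_space)

lemma sets_uniform: "sets uniform = sets (restrict_space borel {0..1})"
  by (simp add: sets_restrict_space)

text \<open>
  Fubini, applied to the set of all \<open>(r, \<omega>)\<close> with \<open>\<omega> \<in> A\<close> that stop at time \<open>n\<close>. Both remaining steps use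
  this density: it is computed for a given \<open>\<rho>\<close>, and it is shown to be almost surely adapted.
\<close>

lemma mixed_detailed_eq:
  assumes \<mu>: "(\<lambda>(r, \<omega>). \<mu> r \<omega>) \<in> restrict_space borel {0..1} \<Otimes>\<^sub>M M \<rightarrow>\<^sub>M count_space ext_times"
    and A: "A \<in> sets M" and n: "n \<in> ext_times"
  shows "mixed_detailed M \<mu> A n = (\<integral>\<^sup>+\<omega>\<in>A. emeasure uniform {r \<in> {0..1}. \<mu> r \<omega> = n} \<partial>M)"
proof -
  \<comment> \<open>Named before the interpretations below, which give the same name to a fact about the product.\<close>
  note section_integral = emeasure_pair_measure_alt
  interpret U: prob_space uniform
    by (rule prob_space_uniform)
  interpret pair_sigma_finite uniform M ..
  define H where "H = {(r, \<omega>). r \<in> {0..1} \<and> \<omega> \<in> A \<and> \<mu> r \<omega> = n}"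
  have \<mu>' [measurable]: "(\<lambda>(r, \<omega>). \<mu> r \<omega>) \<in> uniform \<Otimes>\<^sub>M M \<rightarrow>\<^sub>M count_space ext_times"
    using \<mu> by (simp cong: measurable_cong_sets sets_pair_measure_cong add: sets_uniform)
  have "H = (\<lambda>(r, \<omega>). \<mu> r \<omega>) -` {n} \<inter> space (uniform \<Otimes>\<^sub>M M) \<inter> ({0..1} \<times> A)"
    using sets.sets_into_space[OF A]
    by (auto simp: H_def space_pair_measure space_restrict_space)
  also have "\<dots> \<in> sets (uniform \<Otimes>\<^sub>M M)"
    using n A by (intro sets.Int measurable_sets[OF \<mu>'] pair_measureI)
      (auto simp: sets_restrict_space)
  finally have H: "H \<in> sets (uniform \<Otimes>\<^sub>M M)" .
  have "mixed_detailed M \<mu> A n = (\<integral>\<^sup>+r. emeasure M {\<omega> \<in> A. \<mu> r \<omega> = n} \<partial>uniform)"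
    unfolding mixed_detailed_def by (simp add: nn_integral_restrict_space)
  also have "\<dots> = (\<integral>\<^sup>+r. emeasure M (Pair r -` H) \<partial>uniform)"
    by (intro nn_integral_cong arg_cong2[where f = emeasure])
      (auto simp: H_def space_restrict_space)
  also have "\<dots> = emeasure (uniform \<Otimes>\<^sub>M M) H"
    by (rule section_integral[OF H, symmetric])
  also have "\<dots> = (\<integral>\<^sup>+\<omega>. emeasure uniform ((\<lambda>r. (r, \<omega>)) -` H) \<partial>M)"
    by (rule emeasure_pair_measure_alt2[OF H])
  also have "\<dots> = (\<integral>\<^sup>+\<omega>\<in>A. emeasure uniform {r \<in> {0..1}. \<mu> r \<omega> = n} \<partial>M)"
    by (intro nn_integral_cong) (auto simp: H_def indicator_def vimage_def)
  finally show ?thesis .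
qed

text \<open>
  \<open>S n\<close> is the probability of having stopped by time \<open>n\<close>, and \<open>\<mu> r\<close> is the first time when it exceeds
  the level \<open>r\<close>, i.e. a quantile transform. The strict inequality makes \<open>\<mu> r\<close> at least 1 also for
  \<open>r = 0\<close>, as \<open>S 0 = 0\<close>.
\<close>

lemma randomized_imp_mixed:
  assumes "randomized_stopping_time M F \<rho>"
  shows "\<exists>\<mu>. mixed_stopping_time M F \<mu> \<and>
    (\<forall>A\<in>sets M. \<forall>n\<in>ext_times. mixed_detailed M \<mu> A n = randomized_detailed M \<rho> A n)"
proof -
  define S where "S n \<omega> = (\<Sum>k<n. \<rho> (enat (Suc k)) \<omega>)" for n \<omega>
  define \<mu> where "\<mu> r \<omega> = (if \<exists>n. r < S n \<omega> then enat (LEAST n. r < S n \<omega>) else \<infinity>)" for r \<omega>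
  have \<rho>: "\<rho> n \<in> borel_measurable (F n)"
    and \<rho>_nonneg: "\<And>\<omega>. \<omega> \<in> space M \<Longrightarrow> 0 \<le> \<rho> n \<omega>" if "n \<in> ext_times" for n
    using assms that by (auto simp: randomized_stopping_time_def)
  have S_F: "S k \<in> borel_measurable (F n)" if "enat k \<le> n" for k n
    unfolding S_def
  proof (intro borel_measurable_sum)
    fix j assume "j \<in> {..<k}"
    then have "enat (Suc j) \<le> n"
      using that order_trans[of "enat (Suc j)" "enat k" n] by simp
    then show "\<rho> (enat (Suc j)) \<in> borel_measurable (F n)"
      using measurable_F_mono[OF \<rho>] by simp
  qed
  have S_M [measurable]: "S k \<in> borel_measurable M" for k
    using measurable_from_subalg[OF subalgebra_F[of \<infinity>] S_F] by simp
  have S_sums: "(\<lambda>k. S k \<omega>) \<longlonglongrightarrow> 1 - \<rho> \<infinity> \<omega>" if "\<omega> \<in> space M" for \<omega>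
    using assms that \<rho>_nonneg has_sum_ext_times_iff[of "\<lambda>n. \<rho> n \<omega>" 1]
    by (auto simp: randomized_stopping_time_def sums_def S_def)
  have S_mono: "S m \<omega> \<le> S n \<omega>" if "m \<le> n" "\<omega> \<in> space M" for m n \<omega>
    unfolding S_def using that \<rho>_nonneg by (intro sum_mono2) auto
  have S_le: "S k \<omega> \<le> 1 - \<rho> \<infinity> \<omega>" if "\<omega> \<in> space M" for k \<omega>
    by (rule incseq_le[OF _ S_sums[OF that]]) (auto intro: monoI S_mono that)
  have \<mu>_Suc: "\<mu> r \<omega> = enat (Suc k) \<longleftrightarrow> S k \<omega> \<le> r \<and> r < S (Suc k) \<omega>"
    if "\<omega> \<in> space M" for r \<omega> k
  proof
    assume eq: "\<mu> r \<omega> = enat (Suc k)"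
    then have ex: "\<exists>n. r < S n \<omega>" and least: "(LEAST n. r < S n \<omega>) = Suc k"
      by (auto simp: \<mu>_def split: if_splits)
    show "S k \<omega> \<le> r \<and> r < S (Suc k) \<omega>"
      using LeastI_ex[OF ex] not_less_Least[of k "\<lambda>n. r < S n \<omega>"] by (simp add: least not_less)
  next
    assume r: "S k \<omega> \<le> r \<and> r < S (Suc k) \<omega>"
    have "(LEAST n. r < S n \<omega>) = Suc k"
    proof (rule Least_equality)
      fix n assume "r < S n \<omega>"
      then have "\<not> n \<le> k"
        using S_mono[of n k \<omega>] that r by auto
      then show "Suc k \<le> n"
        by simp
    qed (use r in simp)
    then show "\<mu> r \<omega> = enat (Suc k)"
      using r by (auto simp: \<mu>_def)
  qed
  have \<mu>_inf: "\<mu> r \<omega> = \<infinity> \<longleftrightarrow> (\<forall>n. S n \<omega> \<le> r)" for r \<omega>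
    by (simp add: \<mu>_def flip: not_less)
  have \<mu>_ext: "\<mu> r \<omega> \<in> ext_times" if "0 \<le> r" for r \<omega>
  proof (cases "\<exists>n. r < S n \<omega>")
    case True
    have "(LEAST n. r < S n \<omega>) \<noteq> 0"
      using LeastI_ex[OF True] that by (auto simp: S_def intro: ccontr)
    then show ?thesis
      using True by (auto simp: \<mu>_def one_enat_def)
  qed (simp add: \<mu>_def)
  have mix: "(\<lambda>(r, \<omega>). \<mu> r \<omega>) \<in> restrict_space borel {0..1} \<Otimes>\<^sub>M M \<rightarrow>\<^sub>M count_space ext_times"
    (is "_ \<in> ?B \<rightarrow>\<^sub>M _")
    unfolding measurable_count_space_eq2_countable
  proof (intro conjI ballI)
    have fst_B [measurable]: "fst \<in> borel_measurable ?B"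
      by (rule measurable_compose[OF measurable_fst measurable_restrict_space1]) simp
    show "(\<lambda>(r, \<omega>). \<mu> r \<omega>) \<in> space ?B \<rightarrow> ext_times"
      using \<mu>_ext by (auto simp: space_pair_measure space_restrict_space)
    fix n assume "n \<in> ext_times"
    then show "(\<lambda>(r, \<omega>). \<mu> r \<omega>) -` {n} \<inter> space ?B \<in> sets ?B"
    proof (cases rule: ext_times_cases)
      case (finite k)
      have "(\<lambda>(r, \<omega>). \<mu> r \<omega>) -` {n} \<inter> space ?B =
          {x \<in> space ?B. S k (snd x) \<le> fst x \<and> fst x < S (Suc k) (snd x)}"
        using \<mu>_Suc by (auto simp: finite space_pair_measure)
      also have "\<dots> \<in> sets ?B"
        by measurable
      finally show ?thesis .
    next
      case infinite
      have "(\<lambda>(r, \<omega>). \<mu> r \<omega>) -` {n} \<inter> space ?B = {x \<in> space ?B. \<forall>k. S k (snd x) \<le> fst x}"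
        by (auto simp: infinite \<mu>_inf)
      also have "\<dots> \<in> sets ?B"
        by measurable
      finally show ?thesis .
    qed
  qed
  have "mixed_stopping_time M F \<mu>"
    unfolding mixed_stopping_time_def
  proof (intro conjI ballI mix)
    fix r :: real assume r: "r \<in> {0..1}"
    show "discrete_stopping_time M F (\<mu> r)"
      unfolding discrete_stopping_time_def
    proof (intro conjI ballI)
      show "\<mu> r \<in> space M \<rightarrow> ext_times"
        using r \<mu>_ext by auto
      fix n assume n: "n \<in> ext_times"
      have sp: "space M = space (F n)"
        using space_F n by simp
      from n show "{\<omega> \<in> space M. \<mu> r \<omega> = n} \<in> sets (F n)"
      proof (cases rule: ext_times_cases)
        case (finite k)
        have [measurable]: "S k \<in> borel_measurable (F n)" "S (Suc k) \<in> borel_measurable (F n)"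
          by (auto intro!: S_F simp: finite)
        have "{\<omega> \<in> space M. \<mu> r \<omega> = n} = {\<omega> \<in> space (F n). S k \<omega> \<le> r \<and> r < S (Suc k) \<omega>}"
          using \<mu>_Suc by (auto simp: finite sp[unfolded finite, symmetric])
        also have "\<dots> \<in> sets (F n)"
          by measurable
        finally show ?thesis .
      next
        case infinite
        have [measurable]: "S k \<in> borel_measurable (F n)" for k
          by (auto intro!: S_F simp: infinite)
        have "{\<omega> \<in> space M. \<mu> r \<omega> = n} = {\<omega> \<in> space (F n). \<forall>k. S k \<omega> \<le> r}"
          by (auto simp: infinite \<mu>_inf sp[unfolded infinite, symmetric])
        also have "\<dots> \<in> sets (F n)"
          by measurable
        finally show ?thesis .
      qed
    qed
  qed
  moreover have "mixed_detailed M \<mu> A n = randomized_detailed M \<rho> A n"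
    if A: "A \<in> sets M" and n: "n \<in> ext_times" for A n
    unfolding mixed_detailed_eq[OF mix A n] randomized_detailed_def
  proof (intro nn_integral_cong arg_cong2[where f = "(*)"] refl)
    fix \<omega> assume \<omega>: "\<omega> \<in> space M"
    have \<rho>_inf: "0 \<le> \<rho> \<infinity> \<omega>"
      using \<rho>_nonneg \<omega> by simp
    have "emeasure uniform {r \<in> {0..1}. \<mu> r \<omega> = n} = emeasure lborel {r \<in> {0..1}. \<mu> r \<omega> = n}"
      by (rule emeasure_restrict_space) auto
    also have "\<dots> = ennreal (\<rho> n \<omega>)"
      using n
    proof (cases rule: ext_times_cases)
      case (finite k)
      have S_0: "0 \<le> S k \<omega>"
        using S_mono[of 0 k \<omega>] \<omega> by (simp add: S_def)
      have "{r \<in> {0..1}. \<mu> r \<omega> = n} = {S k \<omega>..<S (Suc k) \<omega>}"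
        using S_0 S_le[OF \<omega>, of "Suc k"] \<rho>_inf by (auto simp: finite \<mu>_Suc[OF \<omega>])
      moreover have "S (Suc k) \<omega> = S k \<omega> + \<rho> n \<omega>"
        by (simp add: S_def finite)
      ultimately show ?thesis
        using \<rho>_nonneg[OF n \<omega>] by simp
    next
      case infinite
      have "{r \<in> {0..1}. \<mu> r \<omega> = n} = {1 - \<rho> \<infinity> \<omega>..1}"
      proof (intro equalityI subsetI)
        fix r assume "r \<in> {r \<in> {0..1}. \<mu> r \<omega> = n}"
        then show "r \<in> {1 - \<rho> \<infinity> \<omega>..1}"
          using LIMSEQ_le_const2[OF S_sums[OF \<omega>], of r] by (auto simp: infinite \<mu>_inf)
      next
        fix r assume "r \<in> {1 - \<rho> \<infinity> \<omega>..1}"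
        moreover have "0 \<le> 1 - \<rho> \<infinity> \<omega>"
          using S_le[OF \<omega>, of 0] by (simp add: S_def)
        ultimately show "r \<in> {r \<in> {0..1}. \<mu> r \<omega> = n}"
          using S_le[OF \<omega>] by (auto simp: infinite \<mu>_inf intro: order_trans)
      qed
      then show ?thesis
        using \<rho>_inf by (simp add: infinite)
    qed
    finally show "emeasure uniform {r \<in> {0..1}. \<mu> r \<omega> = n} = ennreal (\<rho> n \<omega>)" .
  qed
  ultimately show ?thesis
    by blast
qed

section \<open>From mixed stopping times to stopping measures\<close>

text \<open>
  The projection of \<open>\<nu>\<close> is \<open>M\<close> because for each \<open>\<omega>\<close> the sets of those \<open>r\<close> that stop at the various
  times partition the unit interval. The adapted versions of the densities are their conditional
  expectations.
\<close>

lemma mixed_imp_stopping_measure: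
  assumes "prob_space \<nu>" and mixed: "mixed_stopping_time M F \<mu>"
    and distr: "has_detailed_distribution M \<nu> (mixed_detailed M \<mu>)"
  shows "stopping_measure M F \<nu>"
proof -
  interpret U: prob_space uniform
    by (rule prob_space_uniform)
  interpret pair_sigma_finite uniform M ..
  have sets_\<nu> [measurable_cong]: "sets \<nu> = sets (M \<Otimes>\<^sub>M count_space ext_times)"
    using distr by (simp add: has_detailed_distribution_def)
  have space_\<nu>: "space \<nu> = space M \<times> ext_times"
    using sets_eq_imp_space_eq[OF sets_\<nu>] by (simp add: space_pair_measure)
  have \<mu>: "(\<lambda>(r, \<omega>). \<mu> r \<omega>) \<in> restrict_space borel {0..1} \<Otimes>\<^sub>M M \<rightarrow>\<^sub>M count_space ext_times"
    and stop: "\<And>r. r \<in> {0..1} \<Longrightarrow> discrete_stopping_time M F (\<mu> r)"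
    using mixed by (auto simp: mixed_stopping_time_def)
  have \<mu>' [measurable]: "(\<lambda>(r, \<omega>). \<mu> r \<omega>) \<in> uniform \<Otimes>\<^sub>M M \<rightarrow>\<^sub>M count_space ext_times"
    using \<mu> by (simp cong: measurable_cong_sets sets_pair_measure_cong add: sets_uniform)
  have \<mu>_ext: "\<mu> r \<omega> \<in> ext_times" if "r \<in> {0..1}" "\<omega> \<in> space M" for r \<omega>
    using stop[OF that(1)] that(2) by (auto simp: discrete_stopping_time_def)
  define H where "H n = (\<lambda>(r, \<omega>). \<mu> r \<omega>) -` {n} \<inter> space (uniform \<Otimes>\<^sub>M M)" for n
  have H: "H n \<in> sets (uniform \<Otimes>\<^sub>M M)" if "n \<in> ext_times" for n
    unfolding H_def by (rule measurable_sets[OF \<mu>']) (use that in simp)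
  define h where "h n \<omega> = emeasure uniform ((\<lambda>r. (r, \<omega>)) -` H n)" for n \<omega>
  have h [measurable]: "h n \<in> borel_measurable M" if "n \<in> ext_times" for n
    unfolding h_def by (rule measurable_emeasure_Pair2) (rule H[OF that])
  have sec: "(\<lambda>r. (r, \<omega>)) -` H n = {r \<in> {0..1}. \<mu> r \<omega> = n}" if "\<omega> \<in> space M" for n \<omega>
    using that by (auto simp: H_def space_pair_measure space_restrict_space)
  have h_real: "ennreal (enn2real (h n \<omega>)) = h n \<omega>" for n \<omega>
    unfolding h_def by (rule ennreal_enn2real) (simp add: less_top[symmetric])
  have dens: "emeasure \<nu> (A \<times> {n}) = (\<integral>\<^sup>+\<omega>\<in>A. h n \<omega> \<partial>M)"
    if "A \<in> sets M" "n \<in> ext_times" for A n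
  proof -
    have "emeasure \<nu> (A \<times> {n}) = (\<integral>\<^sup>+\<omega>\<in>A. emeasure uniform {r \<in> {0..1}. \<mu> r \<omega> = n} \<partial>M)"
      using distr that by (simp add: has_detailed_distribution_def mixed_detailed_eq[OF \<mu>])
    also have "\<dots> = (\<integral>\<^sup>+\<omega>\<in>A. h n \<omega> \<partial>M)"
      by (intro nn_integral_cong) (simp add: h_def sec)
    finally show ?thesis .
  qed
  have "distr \<nu> M fst = M"
  proof (rule measure_eqI)
    fix A assume "A \<in> sets (distr \<nu> M fst)"
    then have A [measurable]: "A \<in> sets M"
      by simp
    have "emeasure (distr \<nu> M fst) A = emeasure \<nu> (fst -` A \<inter> space \<nu>)"
      by (rule emeasure_distr) simp_all
    also have "fst -` A \<inter> space \<nu> = (\<Union>n\<in>ext_times. A \<times> {n})"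
      using sets.sets_into_space[OF A] by (auto simp: space_\<nu>)
    also have "emeasure \<nu> \<dots> = (\<integral>\<^sup>+n. emeasure \<nu> (A \<times> {n}) \<partial>count_space ext_times)"
      using A by (intro emeasure_UN_countable) (auto simp: disjoint_family_on_def sets_\<nu>)
    also have "\<dots> = (\<integral>\<^sup>+n. (\<integral>\<^sup>+\<omega>\<in>A. h n \<omega> \<partial>M) \<partial>count_space ext_times)"
      using A by (intro nn_integral_cong) (simp add: dens)
    also have "\<dots> = (\<integral>\<^sup>+\<omega>. \<integral>\<^sup>+n. h n \<omega> * indicator A \<omega> \<partial>count_space ext_times \<partial>M)"
      by (intro nn_integral_count_space_nn_integral[symmetric]) auto
    also have "\<dots> = (\<integral>\<^sup>+\<omega>. indicator A \<omega> \<partial>M)"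
    proof (intro nn_integral_cong)
      fix \<omega> assume \<omega>: "\<omega> \<in> space M"
      have "(\<integral>\<^sup>+n. h n \<omega> \<partial>count_space ext_times) =
          emeasure uniform (\<Union>n\<in>ext_times. (\<lambda>r. (r, \<omega>)) -` H n)"
        unfolding h_def
        by (intro emeasure_UN_countable[symmetric])
          (use sets_Pair2[OF H] in \<open>auto simp: disjoint_family_on_def H_def\<close>)
      also have "(\<Union>n\<in>ext_times. (\<lambda>r. (r, \<omega>)) -` H n) = space uniform"
        using \<mu>_ext \<omega> by (auto simp: sec space_restrict_space)
      also have "emeasure uniform \<dots> = 1"
        by (rule U.emeasure_space_1)
      finally show "(\<integral>\<^sup>+n. h n \<omega> * indicator A \<omega> \<partial>count_space ext_times) = indicator A \<omega>"
        by (simp add: nn_integral_multc)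
    qed
    also have "\<dots> = emeasure M A"
      by simp
    finally show "emeasure (distr \<nu> M fst) A = emeasure M A" .
  qed simp
  moreover have "\<exists>g\<in>borel_measurable (F n). AE \<omega> in M. enn2real (h n \<omega>) = g \<omega>"
    if n: "n \<in> {1..<\<infinity>}" for n
  proof -
    have n': "n \<in> ext_times"
      using n by simp
    interpret Fn: finite_measure_subalgebra M "F n"
      by unfold_locales (use n' subalgebra_F in simp)
    have "Pair r -` H n \<in> sets (F n)" if "r \<in> space uniform" for r
    proof -
      have "Pair r -` H n = {\<omega> \<in> space M. \<mu> r \<omega> = n}"
        using that by (auto simp: H_def space_pair_measure)
      then show ?thesis
        using stop[of r] that n' by (simp add: discrete_stopping_time_def space_restrict_space)
    qed
    then have "AE \<omega> in M. h n \<omega> = nn_cond_exp M (F n) (h n) \<omega>"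
      unfolding h_def
      by (intro Fn.AE_section_measure_eq_cond_exp U.sigma_finite_measure_axioms H n')
    then have "AE \<omega> in M. enn2real (h n \<omega>) = enn2real (nn_cond_exp M (F n) (h n) \<omega>)"
      by eventually_elim simp
    moreover have "(\<lambda>\<omega>. enn2real (nn_cond_exp M (F n) (h n) \<omega>)) \<in> borel_measurable (F n)"
      by measurable
    ultimately show ?thesis
      by (intro bexI)
  qed
  ultimately show ?thesis
    unfolding stopping_measure_def using assms(1) sets_\<nu> dens
    by (intro conjI exI[of _ "\<lambda>n \<omega>. enn2real (h n \<omega>)"]) (auto simp: h_real)
qed

end

theorem theorem1:
  fixes M :: "'a measure" and F :: "enat \<Rightarrow> 'a measure" and \<nu> :: "('a \<times> enat) measure"
  assumes "filtered_prob_space M F"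
    and "prob_space \<nu>"
    and "sets \<nu> = sets (M \<Otimes>\<^sub>M count_space ext_times)"
  shows "(stopping_measure M F \<nu> \<longleftrightarrow>
      (\<exists>\<rho>. randomized_stopping_time M F \<rho> \<and>
        has_detailed_distribution M \<nu> (randomized_detailed M \<rho>))) \<and>
    (stopping_measure M F \<nu> \<longleftrightarrow>
      (\<exists>\<beta>. behavior_stopping_time M F \<beta> \<and>
        has_detailed_distribution M \<nu> (behavior_detailed M \<beta>))) \<and>
    (stopping_measure M F \<nu> \<longleftrightarrow>
      (\<exists>\<mu>. mixed_stopping_time M F \<mu> \<and>
        has_detailed_distribution M \<nu> (mixed_detailed M \<mu>)))"
proof -
  interpret filtered_prob_space M F by fact
  let ?r = "\<exists>\<rho>. randomized_stopping_time M F \<rho> \<and>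
    has_detailed_distribution M \<nu> (randomized_detailed M \<rho>)"
  let ?b = "\<exists>\<beta>. behavior_stopping_time M F \<beta> \<and>
    has_detailed_distribution M \<nu> (behavior_detailed M \<beta>)"
  let ?m = "\<exists>\<mu>. mixed_stopping_time M F \<mu> \<and>
    has_detailed_distribution M \<nu> (mixed_detailed M \<mu>)"
  have "stopping_measure M F \<nu> \<Longrightarrow> ?b"
    by (rule stopping_measure_imp_behavior)
  moreover have "?b \<Longrightarrow> ?r"
    using behavior_imp_randomized unfolding has_detailed_distribution_def by metis
  moreover have "?r \<Longrightarrow> ?m"
    using randomized_imp_mixed unfolding has_detailed_distribution_def by metis
  moreover have "?m \<Longrightarrow> stopping_measure M F \<nu>"
    using mixed_imp_stopping_measure[OF assms(2)] by blast
  ultimately show ?thesis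
    by blast
qed

end
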